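(* Let $K$ be a field, let $(A,\circ,[\cdot,\cdot])$ be a Gel'fand-Dorfman bialgebra over $K$, let $E$ be a vector space containing $A$ as a subspace, and let $V$ be a complement of $A$ in $E$. Put $\mathcal{GH}^2(V,A):=\mathcal{GD}(A,V)/\equiv$. Then the map $$\mathcal{GH}^2(V,A)\to \mathrm{Extd}(E,A),\qquad \overline{\Omega(A,V)}\mapsto (A\natural V,\circ,[\cdot,\cdot])$$ is bijective, where $\overline{\Omega(A,V)}$ is the equivalence class of $\Omega(A,V)$ under $\equiv$, and $A\natural V$ (the unified product associated to $\Omega(A,V)$, with underlying space $A\times V$) is regarded as a Gel'fand-Dorfman bialgebraic structure on $E$ through the linear isomorphism $A\times V\to E$, $(a,x)\mapsto a+x$, and represents its equivalence class in $\mathrm{Extd}(E,A)$.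
   Context: All vector spaces, algebras and (bi)linear maps are over a field $K$. A Novikov algebra $(A,\circ)$ is a vector space with a bilinear product such that $(a\circ b)\circ c-a\circ(b\circ c)=(b\circ a)\circ c-b\circ(a\circ c)$ and $(a\circ b)\circ c=(a\circ c)\circ b$ for all $a,b,c$. A Lie algebra is a vector space with a bilinear bracket satisfying $[x,x]=0$ and the Jacobi identity. A Gel'fand-Dorfman bialgebra $(A,\circ,[\cdot,\cdot])$ is a vector space $A$ such that $(A,\circ)$ is a Novikov algebra, $(A,[\cdot,\cdot])$ is a Lie algebra, and $[a,b\circ c]-[c,b\circ a]+[b,a]\circ c-[b,c]\circ a-b\circ[a,c]=0$ for all $a,b,c\in A$. A homomorphism is a linear map preserving both operations; a subalgebra is a subspace closed under both operations. $\mathrm{Extd}(E,A)$: the set of all Gel'fand-Dorfman bialgebraic structures on the vector space $E$ that contain $(A,\circ,[\cdot,\cdot])$ as a subalgebra, modulo the equivalence relation in which two structures are equivalent if there is an isomorphism of Gel'fand-Dorfman bialgebras between them (from $E$ to $E$) whose restriction to $A$ is the identity map. Extending datum of $A$ by $V$: a system $\Omega(A,V)=(l_A,r_A,l_V,r_V,f,\ast,\triangleleft,\triangleright,h,\{\cdot,\cdot\})$ of linear maps $l_A,r_A:A\to gl(V)$, $l_V,r_V:V\to gl(A)$ and bilinear maps $f:V\times V\to A$, $\ast:V\times V\to V$, $\triangleleft:V\times A\to V$, $\triangleright:V\times A\to A$, $h:V\times V\to A$, $\{\cdot,\cdot\}:V\times V\to V$. (Here $gl(V)$ denotes all linear endomorphisms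 of $V$.) $A\natural V$ denotes the vector space $A\times V$ with $$(a,x)\circ(b,y)=(a\circ b+l_V(x)b+r_V(y)a+f(x,y),\ x\ast y+l_A(a)y+r_A(b)x),$$ $$[(a,x),(b,y)]=([a,b]+x\triangleright b-y\triangleright a+h(x,y),\ \{x,y\}+x\triangleleft b-y\triangleleft a).$$ If these operations make $A\times V$ a Gel'fand-Dorfman bialgebra, then $A\natural V$ is called the unified product and $\Omega(A,V)$ is called a Gel'fand-Dorfman extending structure of $A$ by $V$. $\mathcal{GD}(A,V)$ is the set of all Gel'fand-Dorfman extending structures of $A$ by $V$. Equivalence $\equiv$ on $\mathcal{GD}(A,V)$: $\Omega(A,V)\equiv\Omega'(A,V)$ (the maps of $\Omega'$ being denoted by primes) if there exist a linear map $\lambda:V\to A$ and a linear automorphism $\mu$ of $V$ such that for all $a\in A$, $x,y\in V$: (D1) $r_A(a)x=\mu^{-1}(r_A'(a)\mu(x))$; (D2) $l_A(a)x=\mu^{-1}(l_A'(a)\mu(x))$; (D3) $l_V(x)a=\lambda(x)\circ a+l_V'(\mu(x))a-\lambda\mu^{-1}(r_A'(a)\mu(x))$; (D4) $r_V(x)a=a\circ\lambda(x)+r_V'(\mu(x))a-\lambda\mu^{-1}(l_A'(a)\mu(x))$; (D5) $x\ast y=\mu^{-1}(\mu(x)\ast'\mu(y))+\mu^{-1}(l_A'(\lambda(x))\mu(y))+\mu^{-1}(r_A'(\lambda(y))\mu(x))$; (D6) $f(x,y)=\lambda(x)\circ\lambda(y)+l_V'(\mu(x))\lambda(y)+r_V'(\mu(y))\lambda(x)+f'(\mu(x),\mu(y))-\lambda\mu^{-1}(\mu(x)\ast'\mu(y))-\lambda\mu^{-1}(l_A'(\lambda(x))\mu(y))-\lambda\mu^{-1}(r_A'(\lambda(y))\mu(x))$;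 (D7) $x\triangleleft a=\mu^{-1}(\mu(x)\triangleleft' a)$; (D8) $x\triangleright a=[\lambda(x),a]+\mu(x)\triangleright' a-\lambda\mu^{-1}(\mu(x)\triangleleft' a)$; (D9) $h(x,y)=[\lambda(x),\lambda(y)]+\mu(x)\triangleright'\lambda(y)-\mu(y)\triangleright'\lambda(x)+h'(\mu(x),\mu(y))-\lambda\mu^{-1}(\{\mu(x),\mu(y)\}')-\lambda\mu^{-1}(\mu(x)\triangleleft'\lambda(y))+\lambda\mu^{-1}(\mu(y)\triangleleft'\lambda(x))$; (D10) $\{x,y\}=\mu^{-1}(\{\mu(x),\mu(y)\}')+\mu^{-1}(\mu(x)\triangleleft'\lambda(y))-\mu^{-1}(\mu(y)\triangleleft'\lambda(x))$. *)

theory Defs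
  imports "HOL-Analysis.Product_Vector" "HOL-Library.FuncSet"
begin

text \<open>
  A vector space over a field is a subspace \<open>S\<close> of an ambient vector space whose scalar
  multiplication is \<open>s\<close>. Operations on \<open>S\<close> are total functions on the ambient type; only their
  values on \<open>S\<close> matter.
\<close>

definition linear_on ::
    "('k::field \<Rightarrow> 'e::ab_group_add \<Rightarrow> 'e) \<Rightarrow> 'e set \<Rightarrow> 'e set \<Rightarrow> ('e \<Rightarrow> 'e) \<Rightarrow> bool" where
  "linear_on s S T f \<longleftrightarrow>
     f \<in> S \<rightarrow> T \<and>
     (\<forall>x\<in>S. \<forall>y\<in>S. f (x + y) = f x + f y) \<and>
     (\<forall>c. \<forall>x\<in>S. f (s c x) = s c (f x))"

definition bilinear_on ::
    "('k::field \<Rightarrow> 'e::ab_group_add \<Rightarrow> 'e) \<Rightarrow> 'e set \<Rightarrow> 'e set \<Rightarrow> 'e set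
      \<Rightarrow> ('e \<Rightarrow> 'e \<Rightarrow> 'e) \<Rightarrow> bool" where
  "bilinear_on s S T U f \<longleftrightarrow>
     (\<forall>x\<in>S. linear_on s T U (\<lambda>y. f x y)) \<and>
     (\<forall>y\<in>T. linear_on s S U (\<lambda>x. f x y))"


section \<open>Gel'fand-Dorfman bialgebras\<close>

definition novikov_algebra ::
    "('k::field \<Rightarrow> 'e::ab_group_add \<Rightarrow> 'e) \<Rightarrow> 'e set \<Rightarrow> ('e \<Rightarrow> 'e \<Rightarrow> 'e) \<Rightarrow> bool" where
  "novikov_algebra s S m \<longleftrightarrow>
     vector_space s \<and> module.subspace s S \<and> bilinear_on s S S S m \<and>
     (\<forall>a\<in>S. \<forall>b\<in>S. \<forall>c\<in>S. m (m a b) c - m a (m b c) = m (m b a) c - m b (m a c)) \<and>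
     (\<forall>a\<in>S. \<forall>b\<in>S. \<forall>c\<in>S. m (m a b) c = m (m a c) b)"

definition lie_algebra ::
    "('k::field \<Rightarrow> 'e::ab_group_add \<Rightarrow> 'e) \<Rightarrow> 'e set \<Rightarrow> ('e \<Rightarrow> 'e \<Rightarrow> 'e) \<Rightarrow> bool" where
  "lie_algebra s S br \<longleftrightarrow>
     vector_space s \<and> module.subspace s S \<and> bilinear_on s S S S br \<and>
     (\<forall>x\<in>S. br x x = 0) \<and>
     (\<forall>x\<in>S. \<forall>y\<in>S. \<forall>z\<in>S. br x (br y z) + br y (br z x) + br z (br x y) = 0)"

text \<open>The pair consists of the Novikov product and the Lie bracket.\<close>

type_synonym 'e gd_ops = "('e \<Rightarrow> 'e \<Rightarrow> 'e) \<times> ('e \<Rightarrow> 'e \<Rightarrow> 'e)"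

definition gd_bialgebra ::
    "('k::field \<Rightarrow> 'e::ab_group_add \<Rightarrow> 'e) \<Rightarrow> 'e set \<Rightarrow> 'e gd_ops \<Rightarrow> bool" where
  "gd_bialgebra s S = (\<lambda>(m, br).
     novikov_algebra s S m \<and> lie_algebra s S br \<and>
     (\<forall>a\<in>S. \<forall>b\<in>S. \<forall>c\<in>S.
        br a (m b c) - br c (m b a) + m (br b a) c - m (br b c) a - m b (br a c) = 0))"

definition gd_hom ::
    "('k::field \<Rightarrow> 'e::ab_group_add \<Rightarrow> 'e) \<Rightarrow> 'e set \<Rightarrow> 'e gd_ops \<Rightarrow> 'e set \<Rightarrow> 'e gd_ops
      \<Rightarrow> ('e \<Rightarrow> 'e) \<Rightarrow> bool" where
  "gd_hom s S X T Y \<phi> \<longleftrightarrow>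
     linear_on s S T \<phi> \<and>
     (\<forall>x\<in>S. \<forall>y\<in>S. \<phi> (fst X x y) = fst Y (\<phi> x) (\<phi> y)) \<and>
     (\<forall>x\<in>S. \<forall>y\<in>S. \<phi> (snd X x y) = snd Y (\<phi> x) (\<phi> y))"

definition gd_iso ::
    "('k::field \<Rightarrow> 'e::ab_group_add \<Rightarrow> 'e) \<Rightarrow> 'e set \<Rightarrow> 'e gd_ops \<Rightarrow> 'e set \<Rightarrow> 'e gd_ops
      \<Rightarrow> ('e \<Rightarrow> 'e) \<Rightarrow> bool" where
  "gd_iso s S X T Y \<phi> \<longleftrightarrow> gd_hom s S X T Y \<phi> \<and> bij_betw \<phi> S T"

definition gd_subalgebra ::
    "('k::field \<Rightarrow> 'e::ab_group_add \<Rightarrow> 'e) \<Rightarrow> 'e set \<Rightarrow> 'e set \<Rightarrow> 'e gd_ops \<Rightarrow> bool" where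
  "gd_subalgebra s B S X \<longleftrightarrow>
     B \<subseteq> S \<and> module.subspace s B \<and>
     (\<forall>x\<in>B. \<forall>y\<in>B. fst X x y \<in> B \<and> snd X x y \<in> B)"


section \<open>The extending problem\<close>

text \<open>The space \<open>E\<close> is the whole type \<open>'e\<close>, so \<open>A\<close> is a subspace of \<open>E\<close>.\<close>

definition extd_structures ::
    "('k::field \<Rightarrow> 'e::ab_group_add \<Rightarrow> 'e) \<Rightarrow> 'e set \<Rightarrow> 'e gd_ops \<Rightarrow> 'e gd_ops set" where
  "extd_structures s A AX =
     {X. gd_bialgebra s UNIV X \<and> gd_subalgebra s A UNIV X \<and>
         (\<forall>a\<in>A. \<forall>b\<in>A. fst X a b = fst AX a b \<and> snd X a b = snd AX a b)}"

definition extd_rel ::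
    "('k::field \<Rightarrow> 'e::ab_group_add \<Rightarrow> 'e) \<Rightarrow> 'e set \<Rightarrow> 'e gd_ops \<Rightarrow> ('e gd_ops \<times> 'e gd_ops) set" where
  "extd_rel s A AX =
     {(X, Y). X \<in> extd_structures s A AX \<and> Y \<in> extd_structures s A AX \<and>
        (\<exists>\<phi>. gd_iso s UNIV X UNIV Y \<phi> \<and> (\<forall>a\<in>A. \<phi> a = a))}"

definition Extd ::
    "('k::field \<Rightarrow> 'e::ab_group_add \<Rightarrow> 'e) \<Rightarrow> 'e set \<Rightarrow> 'e gd_ops \<Rightarrow> 'e gd_ops set set" where
  "Extd s A AX = extd_structures s A AX // extd_rel s A AX"


section \<open>Extending structures and unified products\<close>

text \<open>
  The fields correspond in order to
  \<open>(l\<^sub>A, r\<^sub>A, l\<^sub>V, r\<^sub>V, f, \<ast>, \<triangleleft>, \<triangleright>, h, {\<cdot>,\<cdot>})\<close>. The type parameters stand for the elements of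
  \<open>A\<close> and of \<open>V\<close>.
\<close>

datatype ('a, 'v) extending_maps = Extending_Maps
  (lA: "'a \<Rightarrow> 'v \<Rightarrow> 'v") (rA: "'a \<Rightarrow> 'v \<Rightarrow> 'v")
  (lV: "'v \<Rightarrow> 'a \<Rightarrow> 'a") (rV: "'v \<Rightarrow> 'a \<Rightarrow> 'a")
  (fV: "'v \<Rightarrow> 'v \<Rightarrow> 'a") (starV: "'v \<Rightarrow> 'v \<Rightarrow> 'v")
  (triL: "'v \<Rightarrow> 'a \<Rightarrow> 'v") (triR: "'v \<Rightarrow> 'a \<Rightarrow> 'a")
  (hV: "'v \<Rightarrow> 'v \<Rightarrow> 'a") (brV: "'v \<Rightarrow> 'v \<Rightarrow> 'v")

text \<open>
  A linear map \<open>A \<rightarrow> gl(V)\<close> is the same as a bilinear map \<open>A \<times> V \<rightarrow> V\<close> in curried form. All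
  maps are extensional (\<open>undefined\<close> outside \<open>A\<close> resp. \<open>V\<close>), so that two data are equal as soon
  as their maps agree on \<open>A\<close> and \<open>V\<close>.
\<close>

definition bilinear_ext ::
    "('k::field \<Rightarrow> 'e::ab_group_add \<Rightarrow> 'e) \<Rightarrow> 'e set \<Rightarrow> 'e set \<Rightarrow> 'e set
      \<Rightarrow> ('e \<Rightarrow> 'e \<Rightarrow> 'e) \<Rightarrow> bool" where
  "bilinear_ext s S T U f \<longleftrightarrow> f \<in> (S \<rightarrow>\<^sub>E (T \<rightarrow>\<^sub>E U)) \<and> bilinear_on s S T U f"

definition extending_datum ::
    "('k::field \<Rightarrow> 'e::ab_group_add \<Rightarrow> 'e) \<Rightarrow> 'e set \<Rightarrow> 'e set \<Rightarrow> ('e, 'e) extending_maps \<Rightarrow> bool" where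
  "extending_datum s A V \<Omega> \<longleftrightarrow>
     bilinear_ext s A V V (lA \<Omega>) \<and> bilinear_ext s A V V (rA \<Omega>) \<and>
     bilinear_ext s V A A (lV \<Omega>) \<and> bilinear_ext s V A A (rV \<Omega>) \<and>
     bilinear_ext s V V A (fV \<Omega>) \<and> bilinear_ext s V V V (starV \<Omega>) \<and>
     bilinear_ext s V A V (triL \<Omega>) \<and> bilinear_ext s V A A (triR \<Omega>) \<and>
     bilinear_ext s V V A (hV \<Omega>) \<and> bilinear_ext s V V V (brV \<Omega>)"

definition unified_ops ::
    "'a::ab_group_add gd_ops \<Rightarrow> ('a, 'v::ab_group_add) extending_maps \<Rightarrow> ('a \<times> 'v) gd_ops" where
  "unified_ops AX \<Omega> =
     ((\<lambda>(a, x) (b, y).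
         (fst AX a b + lV \<Omega> x b + rV \<Omega> y a + fV \<Omega> x y,
          starV \<Omega> x y + lA \<Omega> a y + rA \<Omega> b x)),
      (\<lambda>(a, x) (b, y).
         (snd AX a b + triR \<Omega> x b - triR \<Omega> y a + hV \<Omega> x y,
          brV \<Omega> x y + triL \<Omega> x b - triL \<Omega> y a)))"

definition GD ::
    "('k::field \<Rightarrow> 'e::ab_group_add \<Rightarrow> 'e) \<Rightarrow> 'e set \<Rightarrow> 'e gd_ops \<Rightarrow> 'e set
      \<Rightarrow> ('e, 'e) extending_maps set" where
  "GD s A AX V =
     {\<Omega>. extending_datum s A V \<Omega> \<and>
          gd_bialgebra (module_prod.scale s s) (A \<times> V) (unified_ops AX \<Omega>)}"

text \<open>
  Up to composing the \<open>V\<close>-components with \<open>\<mu>\<^sup>-\<^sup>1\<close> (\<open>\<nu>\<close> below), the equations say that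
  \<open>(a, x) \<mapsto> (a + \<lambda> x, \<mu> x)\<close> is a homomorphism from the product of \<open>\<Omega>\<close> to that of \<open>\<Omega>'\<close>;
  \<open>lam\<close> is \<open>\<lambda>\<close>.
\<close>

definition gd_equations ::
    "'e::ab_group_add set \<Rightarrow> 'e gd_ops \<Rightarrow> 'e set
      \<Rightarrow> ('e, 'e) extending_maps \<Rightarrow> ('e, 'e) extending_maps
      \<Rightarrow> ('e \<Rightarrow> 'e) \<Rightarrow> ('e \<Rightarrow> 'e) \<Rightarrow> bool" where
  "gd_equations A AX V \<Omega> \<Omega>' lam \<mu> \<longleftrightarrow>
     (let m = fst AX; br = snd AX; \<nu> = inv_into V \<mu> in
      (\<forall>a\<in>A. \<forall>x\<in>V. rA \<Omega> a x = \<nu> (rA \<Omega>' a (\<mu> x))) \<and>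
      (\<forall>a\<in>A. \<forall>x\<in>V. lA \<Omega> a x = \<nu> (lA \<Omega>' a (\<mu> x))) \<and>
      (\<forall>a\<in>A. \<forall>x\<in>V. lV \<Omega> x a =
         m (lam x) a + lV \<Omega>' (\<mu> x) a - lam (\<nu> (rA \<Omega>' a (\<mu> x)))) \<and>
      (\<forall>a\<in>A. \<forall>x\<in>V. rV \<Omega> x a =
         m a (lam x) + rV \<Omega>' (\<mu> x) a - lam (\<nu> (lA \<Omega>' a (\<mu> x)))) \<and>
      (\<forall>x\<in>V. \<forall>y\<in>V. starV \<Omega> x y =
         \<nu> (starV \<Omega>' (\<mu> x) (\<mu> y)) + \<nu> (lA \<Omega>' (lam x) (\<mu> y)) + \<nu> (rA \<Omega>' (lam y) (\<mu> x))) \<and>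
      (\<forall>x\<in>V. \<forall>y\<in>V. fV \<Omega> x y =
         m (lam x) (lam y) + lV \<Omega>' (\<mu> x) (lam y) + rV \<Omega>' (\<mu> y) (lam x)
         + fV \<Omega>' (\<mu> x) (\<mu> y) - lam (\<nu> (starV \<Omega>' (\<mu> x) (\<mu> y)))
         - lam (\<nu> (lA \<Omega>' (lam x) (\<mu> y))) - lam (\<nu> (rA \<Omega>' (lam y) (\<mu> x)))) \<and>
      (\<forall>a\<in>A. \<forall>x\<in>V. triL \<Omega> x a = \<nu> (triL \<Omega>' (\<mu> x) a)) \<and>
      (\<forall>a\<in>A. \<forall>x\<in>V. triR \<Omega> x a =
         br (lam x) a + triR \<Omega>' (\<mu> x) a - lam (\<nu> (triL \<Omega>' (\<mu> x) a))) \<and>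
      (\<forall>x\<in>V. \<forall>y\<in>V. hV \<Omega> x y =
         br (lam x) (lam y) + triR \<Omega>' (\<mu> x) (lam y) - triR \<Omega>' (\<mu> y) (lam x)
         + hV \<Omega>' (\<mu> x) (\<mu> y) - lam (\<nu> (brV \<Omega>' (\<mu> x) (\<mu> y)))
         - lam (\<nu> (triL \<Omega>' (\<mu> x) (lam y))) + lam (\<nu> (triL \<Omega>' (\<mu> y) (lam x)))) \<and>
      (\<forall>x\<in>V. \<forall>y\<in>V. brV \<Omega> x y =
         \<nu> (brV \<Omega>' (\<mu> x) (\<mu> y)) + \<nu> (triL \<Omega>' (\<mu> x) (lam y)) - \<nu> (triL \<Omega>' (\<mu> y) (lam x))))"

definition gd_rel ::
    "('k::field \<Rightarrow> 'e::ab_group_add \<Rightarrow> 'e) \<Rightarrow> 'e set \<Rightarrow> 'e gd_ops \<Rightarrow> 'e set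
      \<Rightarrow> (('e, 'e) extending_maps \<times> ('e, 'e) extending_maps) set" where
  "gd_rel s A AX V =
     {(\<Omega>, \<Omega>'). \<Omega> \<in> GD s A AX V \<and> \<Omega>' \<in> GD s A AX V \<and>
        (\<exists>lam \<mu>. linear_on s V A lam \<and> linear_on s V V \<mu> \<and> bij_betw \<mu> V V \<and>
                 gd_equations A AX V \<Omega> \<Omega>' lam \<mu>)}"

definition GH2 ::
    "('k::field \<Rightarrow> 'e::ab_group_add \<Rightarrow> 'e) \<Rightarrow> 'e set \<Rightarrow> 'e gd_ops \<Rightarrow> 'e set
      \<Rightarrow> ('e, 'e) extending_maps set set" where
  "GH2 s A AX V = GD s A AX V // gd_rel s A AX V"

text \<open>
  Transport of operations on \<open>A \<times> V\<close> to \<open>E\<close> along the isomorphism \<open>(a, x) \<mapsto> a + x\<close>,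
  where \<open>E\<close> is the direct sum of \<open>A\<close> and \<open>V\<close>.
\<close>

definition sum_map :: "'e::ab_group_add \<times> 'e \<Rightarrow> 'e" where
  "sum_map = (\<lambda>(a, x). a + x)"

definition transport_op ::
    "'e::ab_group_add set \<Rightarrow> 'e set \<Rightarrow> ('e \<times> 'e \<Rightarrow> 'e \<times> 'e \<Rightarrow> 'e \<times> 'e) \<Rightarrow> 'e \<Rightarrow> 'e \<Rightarrow> 'e" where
  "transport_op A V p u w =
     sum_map (p (inv_into (A \<times> V) sum_map u) (inv_into (A \<times> V) sum_map w))"

definition unified_on_sum ::
    "'e::ab_group_add set \<Rightarrow> 'e gd_ops \<Rightarrow> 'e set \<Rightarrow> ('e, 'e) extending_maps \<Rightarrow> 'e gd_ops" where
  "unified_on_sum A AX V \<Omega> =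
     (transport_op A V (fst (unified_ops AX \<Omega>)), transport_op A V (snd (unified_ops AX \<Omega>)))"

end

theory Submission
  imports Defs
begin

text \<open>
  Write \<open>\<Psi>\<close> for the map sending a datum to the operations it induces on \<open>E = A \<oplus> V\<close>. It sends
  extending structures onto the structures on \<open>E\<close> containing \<open>A\<close>: the components of the products
  \<open>x \<circ> a\<close>, \<open>a \<circ> x\<close>, \<open>x \<circ> y\<close>, \<open>[x, a]\<close>, \<open>[x, y]\<close> (\<open>a \<in> A\<close>, \<open>x, y \<in> V\<close>) along \<open>A\<close> and \<open>V\<close> recover
  the ten maps. A linear automorphism of \<open>E\<close> fixing \<open>A\<close> has the form
  \<open>a + x \<mapsto> a + \<lambda> x + \<mu> x\<close> with \<open>\<mu>\<close> bijective, and comparing components on the same five kinds of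
  products shows that it is a homomorphism iff (D1)-(D10) hold. So \<open>\<equiv>\<close> is the pullback of the
  equivalence on structures along the surjection \<open>\<Psi>\<close>, and the quotients correspond bijectively.
\<close>

section \<open>Quotients by a pulled-back equivalence relation\<close>

text \<open>Since \<open>r\<close> is exactly the preimage of \<open>s\<close> under
  \<open>\<Psi>\<close>, the induced map on classes is well defined because \<open>\<Psi>\<close>
  preserves the relations, injective because it reflects them, and surjective because
  \<open>\<Psi>\<close> is.\<close>

lemma pullback_equiv_quotient_bij:
  assumes s: "equiv B s" and surj: "\<Psi> ` D = B"
    and r: "\<And>x y. (x, y) \<in> r \<longleftrightarrow> x \<in> D \<and> y \<in> D \<and> (\<Psi> x, \<Psi> y) \<in> s"
  shows "equiv D r"
    and "\<exists>F. (\<forall>x\<in>D. F (r `` {x}) = s `` {\<Psi> x}) \<and> bij_betw F (D // r) (B // s)"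
proof -
  show eq: "equiv D r"
  proof (rule equivI)
    show "refl_on D r"
      using surj equiv_class_self[OF s] by (auto simp: refl_on_def r)
    show "sym r"
      using s by (auto simp: sym_def r equiv_def)
    show "trans r"
      using s unfolding trans_def r equiv_def by blast
  qed (auto simp: r)
  \<comment> \<open>Saturating the image of the whole class avoids choosing a
    representative.\<close>
  define F where "F C = s `` (\<Psi> ` C)" for C
  have F: "F (r `` {x}) = s `` {\<Psi> x}" if "x \<in> D" for x
  proof
    have "(x, x) \<in> r" using eq that by (simp add: equiv_def refl_on_def)
    then show "s `` {\<Psi> x} \<subseteq> F (r `` {x})" unfolding F_def by blast
    have "s `` {\<Psi> y} = s `` {\<Psi> x}" if "(x, y) \<in> r" for y
      using that r equiv_class_eq[OF s] by metis
    then show "F (r `` {x}) \<subseteq> s `` {\<Psi> x}" unfolding F_def by blast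
  qed
  have "inj_on F (D // r)"
  proof (rule inj_onI)
    fix C C' assume "C \<in> D // r" "C' \<in> D // r" and FF: "F C = F C'"
    then obtain x y where xy: "x \<in> D" "C = r `` {x}" "y \<in> D" "C' = r `` {y}"
      by (auto elim!: quotientE)
    then have "s `` {\<Psi> x} = s `` {\<Psi> y}" using F FF by simp
    then have "(\<Psi> x, \<Psi> y) \<in> s" using xy surj eq_equiv_class[OF _ s] by blast
    then have "(x, y) \<in> r" using xy r by blast
    then show "C = C'" using xy equiv_class_eq[OF eq] by blast
  qed
  moreover have "F ` (D // r) = B // s"
  proof -
    have "D // r = (\<lambda>x. r `` {x}) ` D" "B // s = (\<lambda>y. s `` {y}) ` B"
      by (auto simp: quotient_def)
    then show ?thesis using F surj by (force simp: image_image)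
  qed
  ultimately show "\<exists>F. (\<forall>x\<in>D. F (r `` {x}) = s `` {\<Psi> x}) \<and> bij_betw F (D // r) (B // s)"
    unfolding bij_betw_def using F by (intro exI[of _ F]) blast
qed

section \<open>Transport of Gel'fand-Dorfman structures\<close>

text \<open>Every element of \<open>T\<close> is some \<open>\<phi> x\<close> with
  \<open>x \<in> S\<close>, so each axiom over \<open>T\<close> is the \<open>\<phi>\<close>-image
  of the same axiom over \<open>S\<close>. The two carriers may lie in different types, which allows
  passing between \<open>A \<times> V\<close> and \<open>E\<close> in either direction.\<close>

lemma gd_bialgebra_transport:
  fixes s :: "'k::field \<Rightarrow> 'p::ab_group_add \<Rightarrow> 'p" and t :: "'k \<Rightarrow> 'q::ab_group_add \<Rightarrow> 'q"
  assumes gd: "gd_bialgebra s S X"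
    and t: "vector_space t" "module.subspace t T"
    and surj: "\<phi> ` S = T"
    and add: "\<And>x y. x \<in> S \<Longrightarrow> y \<in> S \<Longrightarrow> \<phi> (x + y) = \<phi> x + \<phi> y"
    and sc: "\<And>c x. x \<in> S \<Longrightarrow> \<phi> (s c x) = t c (\<phi> x)"
    and m: "\<And>x y. x \<in> S \<Longrightarrow> y \<in> S \<Longrightarrow> \<phi> (fst X x y) = fst Y (\<phi> x) (\<phi> y)"
    and b: "\<And>x y. x \<in> S \<Longrightarrow> y \<in> S \<Longrightarrow> \<phi> (snd X x y) = snd Y (\<phi> x) (\<phi> y)"
  shows "gd_bialgebra t T Y"
proof -
  have vs: "vector_space s" and sub: "module.subspace s S"
    and bm: "bilinear_on s S S S (fst X)" and bb: "bilinear_on s S S S (snd X)"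
    using gd by (auto simp: gd_bialgebra_def novikov_algebra_def lie_algebra_def split: prod.splits)
  interpret s: vector_space s by fact
  interpret t: vector_space t by fact
  have clS: "x + y \<in> S" "x - y \<in> S" "s c x \<in> S" "0 \<in> S" if "x \<in> S" "y \<in> S" for x y c
    using that sub s.subspace_add s.subspace_diff s.subspace_scale s.subspace_0 by auto
  have clm: "fst X x y \<in> S" "snd X x y \<in> S" if "x \<in> S" "y \<in> S" for x y
    using that bm bb by (auto simp: bilinear_on_def linear_on_def)
  have diff: "\<phi> (x - y) = \<phi> x - \<phi> y" if "x \<in> S" "y \<in> S" for x y
    using add[of "x - y" y] clS that by (simp add: algebra_simps)
  have zero: "\<phi> 0 = 0" using diff[of 0 0] clS sub s.subspace_0 by auto
  have inT: "\<phi> x \<in> T" if "x \<in> S" for x using that surj by auto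
  have ballT: "(\<forall>x\<in>T. P x) \<longleftrightarrow> (\<forall>x\<in>S. P (\<phi> x))" for P
    using surj by blast
  have bil: "bilinear_on t T T T p'"
    if p: "bilinear_on s S S S p"
      and h: "\<And>x y. x \<in> S \<Longrightarrow> y \<in> S \<Longrightarrow> p' (\<phi> x) (\<phi> y) = \<phi> (p x y)" for p p'
  proof -
    have "p x y \<in> S" if "x \<in> S" "y \<in> S" for x y
      using that p by (auto simp: bilinear_on_def linear_on_def)
    then show ?thesis
      \<comment> \<open>After \<open>ballT\<close> all arguments are images under
        \<open>\<phi>\<close>; the flipped rules gather their sums and multiples under a single
        \<open>\<phi>\<close>, where \<open>h\<close> applies.\<close>
      using p unfolding bilinear_on_def linear_on_def ballT Pi_iff
      by (auto simp: h inT clS simp flip: add sc)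
  qed
  have eqsX: "fst X (fst X x y) z - fst X x (fst X y z) = fst X (fst X y x) z - fst X y (fst X x z)"
    "fst X (fst X x y) z = fst X (fst X x z) y"
    "snd X x x = 0"
    "snd X x (snd X y z) + snd X y (snd X z x) + snd X z (snd X x y) = 0"
    "snd X x (fst X y z) - snd X z (fst X y x) + fst X (snd X y x) z
      - fst X (snd X y z) x - fst X y (snd X x z) = 0"
    if "x \<in> S" "y \<in> S" "z \<in> S" for x y z
    using gd that
    by (simp_all add: gd_bialgebra_def novikov_algebra_def lie_algebra_def case_prod_beta)
  have eqs: "fst Y (fst Y (\<phi> x) (\<phi> y)) (\<phi> z) - fst Y (\<phi> x) (fst Y (\<phi> y) (\<phi> z)) =
      fst Y (fst Y (\<phi> y) (\<phi> x)) (\<phi> z) - fst Y (\<phi> y) (fst Y (\<phi> x) (\<phi> z))"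
    "fst Y (fst Y (\<phi> x) (\<phi> y)) (\<phi> z) = fst Y (fst Y (\<phi> x) (\<phi> z)) (\<phi> y)"
    "snd Y (\<phi> x) (\<phi> x) = 0"
    "snd Y (\<phi> x) (snd Y (\<phi> y) (\<phi> z)) + snd Y (\<phi> y) (snd Y (\<phi> z) (\<phi> x))
      + snd Y (\<phi> z) (snd Y (\<phi> x) (\<phi> y)) = 0"
    "snd Y (\<phi> x) (fst Y (\<phi> y) (\<phi> z)) - snd Y (\<phi> z) (fst Y (\<phi> y) (\<phi> x))
      + fst Y (snd Y (\<phi> y) (\<phi> x)) (\<phi> z) - fst Y (snd Y (\<phi> y) (\<phi> z)) (\<phi> x)
      - fst Y (\<phi> y) (snd Y (\<phi> x) (\<phi> z)) = 0"
    if xyz: "x \<in> S" "y \<in> S" "z \<in> S" for x y z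
    \<comment> \<open>Apply \<open>\<phi>\<close> to both sides of each identity in \<open>S\<close>
      and push it inwards to the variables.\<close>
    using eqsX[OF xyz, THEN arg_cong[where f = \<phi>]] xyz
    by (simp_all only: clm clS add diff m b zero)
  have "bilinear_on t T T T (fst Y)" "bilinear_on t T T T (snd Y)"
    using bil[OF bm] bil[OF bb] m b by simp_all
  with t show ?thesis
    unfolding gd_bialgebra_def novikov_algebra_def lie_algebra_def case_prod_beta ballT
    by (intro conjI ballI) (assumption | rule eqs)+
qed

section \<open>Isomorphisms and the equivalence of structures on \<open>E\<close>\<close>

lemma (in vector_space) gd_iso_refl: "gd_iso scale UNIV X UNIV X (\<lambda>x. x)"
  by (auto simp: gd_iso_def gd_hom_def linear_on_def bij_betw_def)

lemma gd_iso_trans: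
  assumes "gd_iso s S X T Y f" "gd_iso s T Y U Z g"
  shows "gd_iso s S X U Z (g \<circ> f)"
proof -
  have "f x \<in> T" if "x \<in> S" for x
    using that assms by (auto simp: gd_iso_def gd_hom_def linear_on_def)
  then show ?thesis
    using assms bij_betw_trans[of f S T g U] unfolding gd_iso_def gd_hom_def linear_on_def Pi_def
    by simp
qed

lemma gd_iso_sym:
  assumes f: "gd_iso s UNIV X UNIV Y f"
  shows "gd_iso s UNIV Y UNIV X (inv f)"
proof -
  have bij: "bij f" using f by (simp add: gd_iso_def)
  then have inj: "inj f" by (rule bij_is_inj)
  have surj: "f (inv f y) = y" for y using bij by (simp add: bij_is_surj surj_f_inv_f)
  have h: "f (x + y) = f x + f y" "f (s c x) = s c (f x)"
    "f (fst X x y) = fst Y (f x) (f y)" "f (snd X x y) = snd Y (f x) (f y)" for c x y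
    using f by (auto simp: gd_iso_def gd_hom_def linear_on_def)
  \<comment> \<open>The laws for \<open>inv f\<close> are first shown at arguments of the form
    \<open>f x\<close>, where \<open>h\<close> and injectivity suffice; surjectivity then reaches
    all arguments.\<close>
  have "inv f (f x + f y) = x + y" "inv f (s c (f x)) = s c x"
    "inv f (fst Y (f x) (f y)) = fst X x y" "inv f (snd Y (f x) (f y)) = snd X x y" for c x y
    using inj by (simp_all flip: h)
  then have "inv f (x + y) = inv f x + inv f y" "inv f (s c x) = s c (inv f x)"
    "inv f (fst Y x y) = fst X (inv f x) (inv f y)" "inv f (snd Y x y) = snd X (inv f x) (inv f y)"
    for c x y
    by (metis surj)+
  then show ?thesis using bij by (simp add: gd_iso_def gd_hom_def linear_on_def surj bij_imp_bij_inv)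
qed

lemma (in vector_space) equiv_extd_rel:
  "equiv (extd_structures scale A AX) (extd_rel scale A AX)"
proof (rule equivI)
  show "extd_rel scale A AX \<subseteq> extd_structures scale A AX \<times> extd_structures scale A AX"
    unfolding extd_rel_def by blast
  show "refl_on (extd_structures scale A AX) (extd_rel scale A AX)"
    unfolding refl_on_def extd_rel_def using gd_iso_refl by blast
  show "sym (extd_rel scale A AX)"
  proof (rule symI)
    fix X Y assume XY: "(X, Y) \<in> extd_rel scale A AX"
    then obtain f where f: "gd_iso scale UNIV X UNIV Y f" "\<forall>a\<in>A. f a = a"
      unfolding extd_rel_def by blast
    have "inj f" using f by (simp add: gd_iso_def bij_is_inj)
    then have "\<forall>a\<in>A. inv f a = a" using f(2) by (metis inv_f_f)
    then show "(Y, X) \<in> extd_rel scale A AX"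
      using XY gd_iso_sym[OF f(1)] unfolding extd_rel_def by blast
  qed
  show "trans (extd_rel scale A AX)"
  proof (rule transI)
    fix X Y Z assume XY: "(X, Y) \<in> extd_rel scale A AX" and YZ: "(Y, Z) \<in> extd_rel scale A AX"
    then obtain f g where f: "gd_iso scale UNIV X UNIV Y f" "\<forall>a\<in>A. f a = a"
      and g: "gd_iso scale UNIV Y UNIV Z g" "\<forall>a\<in>A. g a = a"
      unfolding extd_rel_def by blast
    have "\<forall>a\<in>A. (g \<circ> f) a = a" using f g by simp
    then show "(X, Z) \<in> extd_rel scale A AX"
      using XY YZ gd_iso_trans[OF f(1) g(1)] unfolding extd_rel_def by blast
  qed
qed

section \<open>Consequences of bilinearity\<close>

lemma gd_bialgebra_bilinear:
  assumes "gd_bialgebra s S X"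
  shows "bilinear_on s S S S (fst X)" "bilinear_on s S S S (snd X)"
  using assms
  by (auto simp: gd_bialgebra_def novikov_algebra_def lie_algebra_def split: prod.splits)

lemma bilinear_onD:
  assumes "bilinear_on s S T U f"
  shows "x \<in> S \<Longrightarrow> y \<in> T \<Longrightarrow> f x y \<in> U"
    and "x \<in> S \<Longrightarrow> x' \<in> S \<Longrightarrow> y \<in> T \<Longrightarrow> f (x + x') y = f x y + f x' y"
    and "x \<in> S \<Longrightarrow> y \<in> T \<Longrightarrow> y' \<in> T \<Longrightarrow> f x (y + y') = f x y + f x y'"
    and "0 \<in> S \<Longrightarrow> y \<in> T \<Longrightarrow> f 0 y = 0"
    and "x \<in> S \<Longrightarrow> 0 \<in> T \<Longrightarrow> f x 0 = 0"
proof -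
  have l: "linear_on s T U (f x)" if "x \<in> S" for x
    using assms that by (simp add: bilinear_on_def)
  have r: "linear_on s S U (\<lambda>x. f x y)" if "y \<in> T" for y
    using assms that by (simp add: bilinear_on_def)
  show "x \<in> S \<Longrightarrow> y \<in> T \<Longrightarrow> f x y \<in> U"
    and add_l: "x \<in> S \<Longrightarrow> x' \<in> S \<Longrightarrow> y \<in> T \<Longrightarrow> f (x + x') y = f x y + f x' y"
    and add_r: "x \<in> S \<Longrightarrow> y \<in> T \<Longrightarrow> y' \<in> T \<Longrightarrow> f x (y + y') = f x y + f x y'" for x x' y y'
    using l[of x] r[of y] by (auto simp: linear_on_def)
  show "0 \<in> S \<Longrightarrow> y \<in> T \<Longrightarrow> f 0 y = 0"
    and "x \<in> S \<Longrightarrow> 0 \<in> T \<Longrightarrow> f x 0 = 0"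
    using add_l[of 0 0 y] add_r[of x 0 0] by simp_all
qed

text \<open>Polarization: expand the bracket of \<open>x + y\<close> with itself, which vanishes
  along with the brackets of \<open>x\<close> and of \<open>y\<close> with themselves.\<close>

lemma gd_bialgebra_antisym:
  assumes "gd_bialgebra s S X" "x \<in> S" "y \<in> S" "x + y \<in> S"
  shows "snd X x y = - snd X y x"
proof -
  note bil = bilinear_onD(2,3)[OF gd_bialgebra_bilinear(2)[OF assms(1)]]
  have "snd X z z = 0" if "z \<in> S" for z
    using assms(1) that by (simp add: gd_bialgebra_def lie_algebra_def case_prod_beta)
  from this[of "x + y"] this[of x] this[of y] have "snd X x y + snd X y x = 0"
    using assms by (simp add: bil add.commute)
  then show ?thesis by (simp add: eq_neg_iff_add_eq_0)
qed

section \<open>The decomposition of \<open>E\<close> into \<open>A\<close> and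
  \<open>V\<close>\<close>

locale direct_sum = vector_space scale
  for scale :: "'k::field \<Rightarrow> 'e::ab_group_add \<Rightarrow> 'e" +
  fixes A V :: "'e set"
  assumes subA: "subspace A" and subV: "subspace V"
    and AV: "A \<inter> V = {0}" and sum: "\<forall>e. \<exists>a\<in>A. \<exists>v\<in>V. e = a + v"
begin

text \<open>The difference \<open>a - b = y - x\<close> lies in \<open>A \<inter> V\<close>, hence
  is zero. This is what permits comparing components later on.\<close>

lemma sum_eq_iff:
  assumes "a \<in> A" "b \<in> A" "x \<in> V" "y \<in> V"
  shows "a + x = b + y \<longleftrightarrow> a = b \<and> x = y"
proof
  assume "a + x = b + y"
  then have *: "a - b = y - x" by (simp add: algebra_simps)
  have "a - b \<in> A" "y - x \<in> V"
    using assms subA subV subspace_diff by auto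
  with * have "y - x \<in> A \<inter> V" by simp
  then have "y - x = 0" using AV by blast
  with * show "a = b \<and> x = y" by simp
qed simp

lemma bij_sum_map: "bij_betw sum_map (A \<times> V) UNIV"
proof -
  have "inj_on sum_map (A \<times> V)"
    by (auto simp: inj_on_def sum_map_def sum_eq_iff)
  moreover have "e \<in> sum_map ` (A \<times> V)" for e
    using sum[rule_format, of e] by (force simp: sum_map_def)
  ultimately show ?thesis by (auto simp: bij_betw_def)
qed

text \<open>The same inverse as in \<open>transport_op\<close>, named so that transported operations
  can be expressed by the projections \<open>prA\<close> and \<open>prV\<close>.\<close>

definition decomp where "decomp = inv_into (A \<times> V) sum_map"
definition prA where "prA e = fst (decomp e)"
definition prV where "prV e = snd (decomp e)"

lemma decomp_eq: "decomp e = (prA e, prV e)"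
  by (simp add: prA_def prV_def)

lemma decomp_in: "decomp e \<in> A \<times> V"
  using bij_sum_map unfolding decomp_def by (metis UNIV_I bij_betw_def inv_into_into)

lemma prA_in [simp]: "prA e \<in> A" and prV_in [simp]: "prV e \<in> V"
  using decomp_in[of e] by (auto simp: decomp_eq)

lemma pr_sum: "prA e + prV e = e"
proof -
  have "sum_map (decomp e) = e"
    using bij_sum_map unfolding decomp_def by (simp add: bij_betw_def f_inv_into_f)
  then show ?thesis by (simp add: decomp_eq sum_map_def)
qed

lemma prV_eq: "prV e = e - prA e"
  using pr_sum[of e] by (simp add: eq_diff_eq add.commute)

lemma decomp_sum: "a \<in> A \<Longrightarrow> x \<in> V \<Longrightarrow> decomp (a + x) = (a, x)"
  using pr_sum[of "a + x"] by (auto simp: decomp_eq sum_eq_iff)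

lemma prA_sum: "a \<in> A \<Longrightarrow> x \<in> V \<Longrightarrow> prA (a + x) = a"
  and prV_sum: "a \<in> A \<Longrightarrow> x \<in> V \<Longrightarrow> prV (a + x) = x"
  by (simp_all add: prA_def prV_def decomp_sum)

lemma closed [simp, intro]:
  "0 \<in> A" "a \<in> A \<Longrightarrow> b \<in> A \<Longrightarrow> a + b \<in> A" "a \<in> A \<Longrightarrow> b \<in> A \<Longrightarrow> a - b \<in> A" "a \<in> A \<Longrightarrow> scale c a \<in> A"
  "0 \<in> V" "x \<in> V \<Longrightarrow> y \<in> V \<Longrightarrow> x + y \<in> V" "x \<in> V \<Longrightarrow> y \<in> V \<Longrightarrow> x - y \<in> V" "x \<in> V \<Longrightarrow> scale c x \<in> V"
  using subA subV subspace_0 subspace_add subspace_diff subspace_scale by auto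

lemma pr_A [simp]: "a \<in> A \<Longrightarrow> prA a = a" "a \<in> A \<Longrightarrow> prV a = 0"
  and pr_V [simp]: "x \<in> V \<Longrightarrow> prA x = 0" "x \<in> V \<Longrightarrow> prV x = x"
  using prA_sum[of a 0] prV_sum[of a 0] prA_sum[of 0 x] prV_sum[of 0 x] by auto

lemma pr_add [simp]: "prA (u + w) = prA u + prA w" "prV (u + w) = prV u + prV w"
proof -
  have "u + w = (prA u + prA w) + (prV u + prV w)"
    using pr_sum[of u] pr_sum[of w] by (metis add.assoc add.left_commute)
  then show "prA (u + w) = prA u + prA w" "prV (u + w) = prV u + prV w"
    using prA_sum[of "prA u + prA w" "prV u + prV w"] prV_sum[of "prA u + prA w" "prV u + prV w"]
    by auto
qed

lemma pr_scale [simp]: "prA (scale c u) = scale c (prA u)" "prV (scale c u) = scale c (prV u)"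
proof -
  have "scale c u = scale c (prA u) + scale c (prV u)"
    using pr_sum[of u] by (metis scale_right_distrib)
  then show "prA (scale c u) = scale c (prA u)" "prV (scale c u) = scale c (prV u)"
    using prA_sum[of "scale c (prA u)" "scale c (prV u)"]
      prV_sum[of "scale c (prA u)" "scale c (prV u)"] by auto
qed

lemma pr_minus [simp]: "prA (- u) = - prA u" "prV (- u) = - prV u"
  using pr_scale[of "-1" u] by simp_all

lemma pr_diff [simp]: "prA (u - w) = prA u - prA w" "prV (u - w) = prV u - prV w"
  using pr_add[of u "- w"] by simp_all

end

section \<open>Extending structures as structures on \<open>E\<close>\<close>

locale gd_extending = direct_sum scale A V
  for scale :: "'k::field \<Rightarrow> 'e::ab_group_add \<Rightarrow> 'e" and A V +
  fixes circ brk :: "'e \<Rightarrow> 'e \<Rightarrow> 'e"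
  assumes gd: "gd_bialgebra scale A (circ, brk)"
begin

abbreviation \<Psi> :: "('e, 'e) extending_maps \<Rightarrow> 'e gd_ops" where
  "\<Psi> \<equiv> unified_on_sum A (circ, brk) V"

lemmas circ_brk = bilinear_onD[OF gd_bialgebra_bilinear(1)[OF gd], unfolded fst_conv]
  bilinear_onD[OF gd_bialgebra_bilinear(2)[OF gd], unfolded snd_conv]

lemma unified_on_sum_decomp:
  "fst (\<Psi> \<Omega>) u w = sum_map (fst (unified_ops (circ, brk) \<Omega>) (decomp u) (decomp w))"
  "snd (\<Psi> \<Omega>) u w = sum_map (snd (unified_ops (circ, brk) \<Omega>) (decomp u) (decomp w))"
  by (simp_all add: unified_on_sum_def transport_op_def decomp_def)

text \<open>The right-hand sides are grouped as an element of \<open>A\<close> plus an element of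
  \<open>V\<close>, the form needed to compare components.\<close>

lemma unified_on_sum_apply:
  "fst (\<Psi> \<Omega>) u w =
     (circ (prA u) (prA w) + lV \<Omega> (prV u) (prA w) + rV \<Omega> (prV w) (prA u) + fV \<Omega> (prV u) (prV w))
     + (starV \<Omega> (prV u) (prV w) + lA \<Omega> (prA u) (prV w) + rA \<Omega> (prA w) (prV u))"
  "snd (\<Psi> \<Omega>) u w =
     (brk (prA u) (prA w) + triR \<Omega> (prV u) (prA w) - triR \<Omega> (prV w) (prA u) + hV \<Omega> (prV u) (prV w))
     + (brV \<Omega> (prV u) (prV w) + triL \<Omega> (prV u) (prA w) - triL \<Omega> (prV w) (prA u))"
  by (simp_all add: unified_on_sum_decomp decomp_eq unified_ops_def sum_map_def)

lemma extending_datumD: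
  assumes "extending_datum scale A V \<Omega>"
  shows "bilinear_on scale A V V (lA \<Omega>)" "bilinear_on scale A V V (rA \<Omega>)"
    "bilinear_on scale V A A (lV \<Omega>)" "bilinear_on scale V A A (rV \<Omega>)"
    "bilinear_on scale V V A (fV \<Omega>)" "bilinear_on scale V V V (starV \<Omega>)"
    "bilinear_on scale V A V (triL \<Omega>)" "bilinear_on scale V A A (triR \<Omega>)"
    "bilinear_on scale V V A (hV \<Omega>)" "bilinear_on scale V V V (brV \<Omega>)"
  using assms by (auto simp: extending_datum_def bilinear_ext_def)

lemma datum_maps_in:
  assumes "extending_datum scale A V \<Omega>"
  shows "a \<in> A \<Longrightarrow> x \<in> V \<Longrightarrow> lA \<Omega> a x \<in> V" "a \<in> A \<Longrightarrow> x \<in> V \<Longrightarrow> rA \<Omega> a x \<in> V"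
    "a \<in> A \<Longrightarrow> x \<in> V \<Longrightarrow> lV \<Omega> x a \<in> A" "a \<in> A \<Longrightarrow> x \<in> V \<Longrightarrow> rV \<Omega> x a \<in> A"
    "x \<in> V \<Longrightarrow> y \<in> V \<Longrightarrow> fV \<Omega> x y \<in> A" "x \<in> V \<Longrightarrow> y \<in> V \<Longrightarrow> starV \<Omega> x y \<in> V"
    "a \<in> A \<Longrightarrow> x \<in> V \<Longrightarrow> triL \<Omega> x a \<in> V" "a \<in> A \<Longrightarrow> x \<in> V \<Longrightarrow> triR \<Omega> x a \<in> A"
    "x \<in> V \<Longrightarrow> y \<in> V \<Longrightarrow> hV \<Omega> x y \<in> A" "x \<in> V \<Longrightarrow> y \<in> V \<Longrightarrow> brV \<Omega> x y \<in> V"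
  using extending_datumD[OF assms, THEN bilinear_onD(1)] by auto

lemma datum_maps_zero:
  assumes "extending_datum scale A V \<Omega>" "a \<in> A" "x \<in> V"
  shows "lA \<Omega> 0 x = 0" "rA \<Omega> 0 x = 0" "lV \<Omega> 0 a = 0" "rV \<Omega> 0 a = 0"
    "fV \<Omega> 0 x = 0" "starV \<Omega> 0 x = 0" "triL \<Omega> 0 a = 0" "triR \<Omega> 0 a = 0"
    "hV \<Omega> 0 x = 0" "brV \<Omega> 0 x = 0"
    "lA \<Omega> a 0 = 0" "rA \<Omega> a 0 = 0" "lV \<Omega> x 0 = 0" "rV \<Omega> x 0 = 0"
    "fV \<Omega> x 0 = 0" "starV \<Omega> x 0 = 0" "triL \<Omega> x 0 = 0" "triR \<Omega> x 0 = 0"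
    "hV \<Omega> x 0 = 0" "brV \<Omega> x 0 = 0"
  using extending_datumD[OF assms(1), THEN bilinear_onD(4)]
    extending_datumD[OF assms(1), THEN bilinear_onD(5)] assms(2-) by auto

text \<open>An element of \<open>A\<close> has \<open>V\<close>-part 0 and conversely, so all terms
  of the product formula with a zero argument drop out.\<close>

lemma unified_on_sum_parts:
  assumes "extending_datum scale A V \<Omega>" "a \<in> A" "b \<in> A" "x \<in> V" "y \<in> V"
  shows "fst (\<Psi> \<Omega>) a b = circ a b" "snd (\<Psi> \<Omega>) a b = brk a b"
    "fst (\<Psi> \<Omega>) x a = lV \<Omega> x a + rA \<Omega> a x" "fst (\<Psi> \<Omega>) a x = rV \<Omega> x a + lA \<Omega> a x"
    "snd (\<Psi> \<Omega>) x a = triR \<Omega> x a + triL \<Omega> x a"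
    "fst (\<Psi> \<Omega>) x y = fV \<Omega> x y + starV \<Omega> x y" "snd (\<Psi> \<Omega>) x y = hV \<Omega> x y + brV \<Omega> x y"
  using assms by (simp_all add: unified_on_sum_apply datum_maps_zero circ_brk)

lemma unified_ops_in:
  assumes "extending_datum scale A V \<Omega>" "p \<in> A \<times> V" "q \<in> A \<times> V"
  shows "fst (unified_ops (circ, brk) \<Omega>) p q \<in> A \<times> V"
    "snd (unified_ops (circ, brk) \<Omega>) p q \<in> A \<times> V"
  using assms by (auto simp: unified_ops_def datum_maps_in circ_brk)

lemma decomp_sum_map: "p \<in> A \<times> V \<Longrightarrow> decomp (sum_map p) = p"
  by (auto simp: sum_map_def decomp_sum)

lemma
  shows vector_space_prod: "vector_space (module_prod.scale scale scale)"
    and subspace_prod: "module.subspace (module_prod.scale scale scale) (A \<times> V)"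
    and scale_prod: "module_prod.scale scale scale c (a, x) = (scale c a, scale c x)"
proof -
  interpret P: vector_space_prod scale scale ..
  show "vector_space (module_prod.scale scale scale)" ..
  show "module.subspace (module_prod.scale scale scale) (A \<times> V)"
    using subA subV by (rule P.subspace_Times)
  show "module_prod.scale scale scale c (a, x) = (scale c a, scale c x)"
    by (rule P.scale_prod)
qed

text \<open>The maps \<open>sum_map\<close> and \<open>decomp\<close> are mutually inverse between
  \<open>A \<times> V\<close> and \<open>E\<close>, so the structure is transported along one for
  each direction.\<close>

lemma gd_unified_iff:
  assumes \<Omega>: "extending_datum scale A V \<Omega>"
  shows "gd_bialgebra (module_prod.scale scale scale) (A \<times> V) (unified_ops (circ, brk) \<Omega>)
    \<longleftrightarrow> gd_bialgebra scale UNIV (\<Psi> \<Omega>)"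
proof
  assume "gd_bialgebra (module_prod.scale scale scale) (A \<times> V) (unified_ops (circ, brk) \<Omega>)"
  then show "gd_bialgebra scale UNIV (\<Psi> \<Omega>)"
  proof (rule gd_bialgebra_transport[where \<phi> = sum_map])
    show "vector_space scale" ..
    show "subspace UNIV" by simp
    show "sum_map ` (A \<times> V) = UNIV" using bij_sum_map by (simp add: bij_betw_def)
  qed (auto simp: sum_map_def scale_prod scale_right_distrib unified_on_sum_decomp decomp_sum)
next
  assume "gd_bialgebra scale UNIV (\<Psi> \<Omega>)"
  then show "gd_bialgebra (module_prod.scale scale scale) (A \<times> V) (unified_ops (circ, brk) \<Omega>)"
  proof (rule gd_bialgebra_transport[where \<phi> = decomp])
    show "range decomp = A \<times> V"
    proof
      show "A \<times> V \<subseteq> range decomp"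
      proof
        fix p assume "p \<in> A \<times> V"
        then show "p \<in> range decomp" using decomp_sum_map by (metis rangeI)
      qed
    qed (use decomp_in in blast)
  \<comment> \<open>Closure of the unified operations matters here: \<open>decomp\<close> undoes
    \<open>sum_map\<close> only on \<open>A \<times> V\<close>.\<close>
  qed (simp_all add: vector_space_prod subspace_prod unified_on_sum_decomp decomp_sum_map
      unified_ops_in[OF \<Omega>] decomp_in, simp_all add: decomp_eq scale_prod)
qed

lemma unified_on_sum_extd:
  assumes "\<Omega> \<in> GD scale A (circ, brk) V"
  shows "\<Psi> \<Omega> \<in> extd_structures scale A (circ, brk)"
proof -
  have \<Omega>: "extending_datum scale A V \<Omega>" and "gd_bialgebra scale UNIV (\<Psi> \<Omega>)"
    using assms gd_unified_iff by (auto simp: GD_def)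
  then show ?thesis
    using unified_on_sum_parts(1,2)[OF \<Omega> _ _ closed(5) closed(5)]
    by (simp add: extd_structures_def gd_subalgebra_def subA circ_brk)
qed

text \<open>The surjectivity of \<open>\<Psi>\<close>: the datum consists of the \<open>A\<close>-
  and \<open>V\<close>-components of the products in \<open>X\<close>, and bilinearity reassembles
  \<open>X\<close> from them.\<close>

lemma extd_unified_on_sum:
  assumes X: "X \<in> extd_structures scale A (circ, brk)"
  shows "X \<in> \<Psi> ` GD scale A (circ, brk) V"
proof -
  have gdX: "gd_bialgebra scale UNIV X"
    and XA: "\<And>a b. a \<in> A \<Longrightarrow> b \<in> A \<Longrightarrow> fst X a b = circ a b"
      "\<And>a b. a \<in> A \<Longrightarrow> b \<in> A \<Longrightarrow> snd X a b = brk a b"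
    using X by (auto simp: extd_structures_def)
  note bil = gd_bialgebra_bilinear[OF gdX]
  \<comment> \<open>Restriction makes the maps extensional, as \<open>extending_datum\<close>
    requires.\<close>
  define cut where "cut S T f = (\<lambda>x\<in>S. \<lambda>y\<in>T. f x y)" for S T and f :: "'e \<Rightarrow> 'e \<Rightarrow> 'e"
  define \<Omega> where "\<Omega> = Extending_Maps
    (cut A V (\<lambda>a x. prV (fst X a x))) (cut A V (\<lambda>a x. prV (fst X x a)))
    (cut V A (\<lambda>x a. prA (fst X x a))) (cut V A (\<lambda>x a. prA (fst X a x)))
    (cut V V (\<lambda>x y. prA (fst X x y))) (cut V V (\<lambda>x y. prV (fst X x y)))
    (cut V A (\<lambda>x a. prV (snd X x a))) (cut V A (\<lambda>x a. prA (snd X x a)))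
    (cut V V (\<lambda>x y. prA (snd X x y))) (cut V V (\<lambda>x y. prV (snd X x y)))"
  have bil_ext: "bilinear_ext scale S T U (cut S T f)"
    if "bilinear_on scale UNIV UNIV U f" "subspace S" "subspace T" for S T U f
    using that unfolding bilinear_ext_def bilinear_on_def linear_on_def cut_def Pi_iff
    by (auto simp: subspace_add subspace_scale)
  \<comment> \<open>The swapped forms serve \<open>rA\<close> and \<open>rV\<close>, whose curried
    arguments come in the order opposite to that of the product.\<close>
  have pr: "bilinear_on scale UNIV UNIV A (\<lambda>u w. prA (f u w))"
      "bilinear_on scale UNIV UNIV V (\<lambda>u w. prV (f u w))"
      "bilinear_on scale UNIV UNIV A (\<lambda>u w. prA (f w u))"
      "bilinear_on scale UNIV UNIV V (\<lambda>u w. prV (f w u))"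
    if "bilinear_on scale UNIV UNIV UNIV f" for f
    using that by (simp_all add: bilinear_on_def linear_on_def)
  have datum: "extending_datum scale A V \<Omega>"
    unfolding extending_datum_def \<Omega>_def extending_maps.sel
    using pr[OF bil(1)] pr[OF bil(2)] by (intro conjI bil_ext subA subV) simp_all
  have "fst (\<Psi> \<Omega>) u w = fst X u w" for u w
  proof -
    have "fst X u w = fst X (prA u + prV u) (prA w + prV w)" by (simp add: pr_sum)
    also have "\<dots> = circ (prA u) (prA w) + fst X (prV u) (prA w) + fst X (prA u) (prV w)
        + fst X (prV u) (prV w)"
      by (simp add: bilinear_onD[OF bil(1)] XA algebra_simps)
    also have "\<dots> = fst (\<Psi> \<Omega>) u w"
      \<comment> \<open>The instance of \<open>prV_eq\<close> rewrites only
        \<open>V\<close>-components of products, so that each cancels against its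
        \<open>A\<close>-component, while \<open>prV u\<close> and \<open>prV w\<close>
        stay.\<close>
      by (simp add: unified_on_sum_apply \<Omega>_def cut_def prV_eq[of "fst X _ _"])
    finally show ?thesis by simp
  qed
  moreover have "snd (\<Psi> \<Omega>) u w = snd X u w" for u w
  proof -
    have "snd X u w = snd X (prA u + prV u) (prA w + prV w)" by (simp add: pr_sum)
    also have "\<dots> = brk (prA u) (prA w) + snd X (prV u) (prA w) - snd X (prV w) (prA u)
        + snd X (prV u) (prV w)"
      \<comment> \<open>The datum records brackets with the \<open>V\<close>-argument first only;
        the other order enters through antisymmetry, whence the minus sign.\<close>
      using gd_bialgebra_antisym[OF gdX, of "prA u" "prV w"]
      by (simp add: bilinear_onD[OF bil(2)] XA algebra_simps)
    also have "\<dots> = snd (\<Psi> \<Omega>) u w"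
      by (simp add: unified_on_sum_apply \<Omega>_def cut_def prV_eq[of "snd X _ _"])
    finally show ?thesis by simp
  qed
  ultimately have eq: "\<Psi> \<Omega> = X" by (simp add: prod_eq_iff fun_eq_iff)
  then have "\<Omega> \<in> GD scale A (circ, brk) V"
    using datum gdX gd_unified_iff[OF datum] by (simp add: GD_def)
  with eq show ?thesis by blast
qed

section \<open>Automorphisms fixing \<open>A\<close> and the ten equations\<close>

definition glue :: "('e \<Rightarrow> 'e) \<Rightarrow> ('e \<Rightarrow> 'e) \<Rightarrow> 'e \<Rightarrow> 'e" where
  "glue lam \<mu> e = prA e + lam (prV e) + \<mu> (prV e)"

text \<open>By bilinearity it suffices to test products of elements of \<open>A\<close> and
  \<open>V\<close>. Two elements of \<open>A\<close> give nothing new, since both structures agree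
  there and \<open>\<phi>\<close> fixes \<open>A\<close>; the bracket of \<open>A\<close> with
  \<open>V\<close> follows from that of \<open>V\<close> with \<open>A\<close>.\<close>

lemma extd_hom_iff:
  assumes X: "X \<in> extd_structures scale A (circ, brk)" and Y: "Y \<in> extd_structures scale A (circ, brk)"
    and lin: "linear_on scale UNIV UNIV \<phi>" and \<phi>A: "\<forall>a\<in>A. \<phi> a = a"
  shows "gd_hom scale UNIV X UNIV Y \<phi> \<longleftrightarrow>
    (\<forall>a\<in>A. \<forall>x\<in>V. \<phi> (fst X x a) = fst Y (\<phi> x) a) \<and>
    (\<forall>a\<in>A. \<forall>x\<in>V. \<phi> (fst X a x) = fst Y a (\<phi> x)) \<and>
    (\<forall>x\<in>V. \<forall>y\<in>V. \<phi> (fst X x y) = fst Y (\<phi> x) (\<phi> y)) \<and>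
    (\<forall>a\<in>A. \<forall>x\<in>V. \<phi> (snd X x a) = snd Y (\<phi> x) a) \<and>
    (\<forall>x\<in>V. \<forall>y\<in>V. \<phi> (snd X x y) = snd Y (\<phi> x) (\<phi> y))"
    (is "_ \<longleftrightarrow> ?R")
proof
  assume "gd_hom scale UNIV X UNIV Y \<phi>"
  then show ?R by (simp add: gd_hom_def \<phi>A)
next
  assume R: ?R
  have gdX: "gd_bialgebra scale UNIV X" and gdY: "gd_bialgebra scale UNIV Y"
    and XA: "\<And>a b. a \<in> A \<Longrightarrow> b \<in> A \<Longrightarrow> fst X a b \<in> A \<and> fst Y a b = fst X a b"
      "\<And>a b. a \<in> A \<Longrightarrow> b \<in> A \<Longrightarrow> snd X a b \<in> A \<and> snd Y a b = snd X a b"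
    using X Y by (auto simp: extd_structures_def gd_subalgebra_def)
  note bilX = gd_bialgebra_bilinear[OF gdX, THEN bilinear_onD(2)]
    gd_bialgebra_bilinear[OF gdX, THEN bilinear_onD(3)]
  note bilY = gd_bialgebra_bilinear[OF gdY, THEN bilinear_onD(2)]
    gd_bialgebra_bilinear[OF gdY, THEN bilinear_onD(3)]
  have add: "\<phi> (u + w) = \<phi> u + \<phi> w" and minus: "\<phi> (- u) = - \<phi> u" for u w
  proof -
    show add: "\<phi> (u + w) = \<phi> u + \<phi> w" for u w
      using lin by (simp add: linear_on_def)
    then show "\<phi> (- u) = - \<phi> u"
      using add[of u "- u"] add[of 0 0] by (simp add: eq_neg_iff_add_eq_0 add.commute)
  qed
  have Rflip: "\<phi> (snd X a x) = snd Y a (\<phi> x)" if "a \<in> A" "x \<in> V" for a x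
    using R that gd_bialgebra_antisym[OF gdX, of a x] gd_bialgebra_antisym[OF gdY, of a "\<phi> x"]
    by (simp add: minus)
  have "\<phi> (fst X u w) = fst Y (\<phi> u) (\<phi> w)" for u w
  proof -
    have "\<phi> (fst X (prA u + prV u) (prA w + prV w))
        = fst Y (\<phi> (prA u + prV u)) (\<phi> (prA w + prV w))"
      using R by (simp add: bilX bilY add \<phi>A XA)
    then show ?thesis by (simp add: pr_sum)
  qed
  moreover have "\<phi> (snd X u w) = snd Y (\<phi> u) (\<phi> w)" for u w
  proof -
    have "\<phi> (snd X (prA u + prV u) (prA w + prV w))
        = snd Y (\<phi> (prA u + prV u)) (\<phi> (prA w + prV w))"
      using R by (simp add: bilX bilY add \<phi>A XA Rflip)
    then show ?thesis by (simp add: pr_sum)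
  qed
  ultimately show "gd_hom scale UNIV X UNIV Y \<phi>"
    using lin by (simp add: gd_hom_def)
qed

text \<open>Each of the five conditions of \<open>extd_hom_iff\<close> is one equation in
  \<open>E\<close>. Its \<open>A\<close>- and \<open>V\<close>-components are two of the equations
  in \<open>gd_equations\<close>, which yields all ten.\<close>

lemma glue_gd_iso_iff:
  assumes \<Omega>: "\<Omega> \<in> GD scale A (circ, brk) V" and \<Omega>': "\<Omega>' \<in> GD scale A (circ, brk) V"
    and lam: "linear_on scale V A lam" and \<mu>: "linear_on scale V V \<mu>" and bij: "bij_betw \<mu> V V"
  shows "gd_iso scale UNIV (\<Psi> \<Omega>) UNIV (\<Psi> \<Omega>') (glue lam \<mu>)
    \<longleftrightarrow> gd_equations A (circ, brk) V \<Omega> \<Omega>' lam \<mu>"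
proof -
  define \<nu> where "\<nu> = inv_into V \<mu>"
  have D: "extending_datum scale A V \<Omega>" and D': "extending_datum scale A V \<Omega>'"
    using \<Omega> \<Omega>' by (auto simp: GD_def)
  have lam_in: "lam x \<in> A" and \<mu>_in: "\<mu> x \<in> V" if "x \<in> V" for x
    using lam \<mu> that by (auto simp: linear_on_def)
  have lam_add: "lam (x + y) = lam x + lam y" and \<mu>_add: "\<mu> (x + y) = \<mu> x + \<mu> y"
    if "x \<in> V" "y \<in> V" for x y
    using lam \<mu> that by (auto simp: linear_on_def)
  have lam0: "lam 0 = 0" and \<mu>0: "\<mu> 0 = 0"
    using lam_add[of 0 0] \<mu>_add[of 0 0] by auto
  have \<nu>_in: "\<nu> y \<in> V" and \<mu>\<nu>: "\<mu> (\<nu> y) = y" if "y \<in> V" for y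
    using bij that by (auto simp: \<nu>_def bij_betw_def inv_into_into f_inv_into_f)
  have \<nu>\<mu>: "\<nu> (\<mu> x) = x" if "x \<in> V" for x
    using bij that by (simp add: \<nu>_def bij_betw_def)
  \<comment> \<open>The inverse inherits additivity from \<open>\<mu>\<close>; it is needed to
    distribute \<open>\<nu>\<close> over the \<open>V\<close>-component of a product.\<close>
  have \<nu>_add: "\<nu> (x + y) = \<nu> x + \<nu> y" if "x \<in> V" "y \<in> V" for x y
    using \<nu>\<mu>[of "\<nu> x + \<nu> y"] that by (simp add: \<mu>_add \<nu>_in \<mu>\<nu>)
  have \<nu>_diff: "\<nu> (x - y) = \<nu> x - \<nu> y" if "x \<in> V" "y \<in> V" for x y
    using \<nu>_add[of "x - y" y] that by (simp add: eq_diff_eq)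
  have lam_diff: "lam (x - y) = lam x - lam y" if "x \<in> V" "y \<in> V" for x y
    using lam_add[of "x - y" y] that by (simp add: eq_diff_eq)
  have glueA: "\<forall>a\<in>A. glue lam \<mu> a = a"
    by (simp add: glue_def lam0 \<mu>0)
  have glueV: "glue lam \<mu> x = lam x + \<mu> x" if "x \<in> V" for x
    using that by (simp add: glue_def)
  have lin: "linear_on scale UNIV UNIV (glue lam \<mu>)"
    using lam \<mu> by (simp add: linear_on_def glue_def scale_right_distrib algebra_simps)
  \<comment> \<open>The key computation: the \<open>V\<close>-component forces
    \<open>r = \<nu> r'\<close>, and substituting this into the \<open>A\<close>-component
    \<open>l + lam r = l'\<close> produces the correction terms
    \<open>lam (\<nu> ...)\<close>.\<close>
  have glue_eq: "glue lam \<mu> (l + r) = l' + r' \<longleftrightarrow> l = l' - lam (\<nu> r') \<and> r = \<nu> r'"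
    if "l \<in> A" "r \<in> V" "l' \<in> A" "r' \<in> V" for l r l' r'
  proof -
    have "glue lam \<mu> (l + r) = (l + lam r) + \<mu> r" using that by (simp add: glue_def)
    then have "glue lam \<mu> (l + r) = l' + r' \<longleftrightarrow> l + lam r = l' \<and> \<mu> r = r'"
      using that by (simp add: sum_eq_iff lam_in \<mu>_in)
    also have "\<mu> r = r' \<longleftrightarrow> r = \<nu> r'" using that \<nu>\<mu> \<mu>\<nu> by auto
    finally show ?thesis by (auto simp: algebra_simps)
  qed
  note ins = datum_maps_in[OF D] datum_maps_in[OF D'] lam_in \<mu>_in \<nu>_in circ_brk
  have "bij (glue lam \<mu>)"
  proof (rule bijI)
    show "inj (glue lam \<mu>)"
    proof (rule injI)
      fix u w assume "glue lam \<mu> u = glue lam \<mu> w"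
      then have *: "prA u + lam (prV u) = prA w + lam (prV w) \<and> \<mu> (prV u) = \<mu> (prV w)"
        unfolding glue_def by (subst (asm) sum_eq_iff) (auto simp: lam_in \<mu>_in)
      from * have "\<nu> (\<mu> (prV u)) = \<nu> (\<mu> (prV w))" by (simp only:)
      then have V: "prV u = prV w" by (simp only: \<nu>\<mu> prV_in)
      from * have "prA u = prA w" unfolding V by (simp only: add_right_cancel)
      with V have "prA u + prV u = prA w + prV w" by (simp only:)
      then show "u = w" by (simp only: pr_sum)
    qed
    \<comment> \<open>The preimage is the solution \<open>l + r\<close> that \<open>glue_eq\<close>
      prescribes for \<open>l' = prA e\<close> and \<open>r' = prV e\<close>.\<close>
    have "glue lam \<mu> ((prA e - lam (\<nu> (prV e))) + \<nu> (prV e)) = e" for e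
      using glue_eq[of "prA e - lam (\<nu> (prV e))" "\<nu> (prV e)" "prA e" "prV e"]
      by (simp add: lam_in \<nu>_in pr_sum)
    then show "surj (glue lam \<mu>)" by (rule surjI)
  qed
  then have iso: "gd_iso scale UNIV (\<Psi> \<Omega>) UNIV (\<Psi> \<Omega>') (glue lam \<mu>)
      \<longleftrightarrow> gd_hom scale UNIV (\<Psi> \<Omega>) UNIV (\<Psi> \<Omega>') (glue lam \<mu>)"
    by (simp add: gd_iso_def)
  have VA: "glue lam \<mu> (fst (\<Psi> \<Omega>) x a) = fst (\<Psi> \<Omega>') (glue lam \<mu> x) a \<longleftrightarrow>
      lV \<Omega> x a = circ (lam x) a + lV \<Omega>' (\<mu> x) a - lam (\<nu> (rA \<Omega>' a (\<mu> x)))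
      \<and> rA \<Omega> a x = \<nu> (rA \<Omega>' a (\<mu> x))" if "a \<in> A" "x \<in> V" for a x
  proof -
    have "fst (\<Psi> \<Omega>') (glue lam \<mu> x) a = (circ (lam x) a + lV \<Omega>' (\<mu> x) a) + rA \<Omega>' a (\<mu> x)"
      using that by (simp add: glueV unified_on_sum_apply ins datum_maps_zero[OF D'])
    then show ?thesis
      using that by (simp add: unified_on_sum_parts(3)[OF D _ _ _ closed(5)] glue_eq ins)
  qed
  have AV: "glue lam \<mu> (fst (\<Psi> \<Omega>) a x) = fst (\<Psi> \<Omega>') a (glue lam \<mu> x) \<longleftrightarrow>
      rV \<Omega> x a = circ a (lam x) + rV \<Omega>' (\<mu> x) a - lam (\<nu> (lA \<Omega>' a (\<mu> x)))
      \<and> lA \<Omega> a x = \<nu> (lA \<Omega>' a (\<mu> x))" if "a \<in> A" "x \<in> V" for a x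
  proof -
    have "fst (\<Psi> \<Omega>') a (glue lam \<mu> x) = (circ a (lam x) + rV \<Omega>' (\<mu> x) a) + lA \<Omega>' a (\<mu> x)"
      using that by (simp add: glueV unified_on_sum_apply ins datum_maps_zero[OF D'])
    then show ?thesis
      using that by (simp add: unified_on_sum_parts(4)[OF D _ _ _ closed(5)] glue_eq ins)
  qed
  have brVA: "glue lam \<mu> (snd (\<Psi> \<Omega>) x a) = snd (\<Psi> \<Omega>') (glue lam \<mu> x) a \<longleftrightarrow>
      triR \<Omega> x a = brk (lam x) a + triR \<Omega>' (\<mu> x) a - lam (\<nu> (triL \<Omega>' (\<mu> x) a))
      \<and> triL \<Omega> x a = \<nu> (triL \<Omega>' (\<mu> x) a)" if "a \<in> A" "x \<in> V" for a x
  proof -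
    have "snd (\<Psi> \<Omega>') (glue lam \<mu> x) a = (brk (lam x) a + triR \<Omega>' (\<mu> x) a) + triL \<Omega>' (\<mu> x) a"
      using that by (simp add: glueV unified_on_sum_apply ins datum_maps_zero[OF D'])
    then show ?thesis
      using that by (simp add: unified_on_sum_parts(5)[OF D _ _ _ closed(5)] glue_eq ins)
  qed
  have VV: "glue lam \<mu> (fst (\<Psi> \<Omega>) x y) = fst (\<Psi> \<Omega>') (glue lam \<mu> x) (glue lam \<mu> y) \<longleftrightarrow>
      fV \<Omega> x y = circ (lam x) (lam y) + lV \<Omega>' (\<mu> x) (lam y) + rV \<Omega>' (\<mu> y) (lam x)
         + fV \<Omega>' (\<mu> x) (\<mu> y) - lam (\<nu> (starV \<Omega>' (\<mu> x) (\<mu> y)))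
         - lam (\<nu> (lA \<Omega>' (lam x) (\<mu> y))) - lam (\<nu> (rA \<Omega>' (lam y) (\<mu> x)))
      \<and> starV \<Omega> x y =
         \<nu> (starV \<Omega>' (\<mu> x) (\<mu> y)) + \<nu> (lA \<Omega>' (lam x) (\<mu> y)) + \<nu> (rA \<Omega>' (lam y) (\<mu> x))"
    if "x \<in> V" "y \<in> V" for x y
  proof -
    have "fst (\<Psi> \<Omega>') (glue lam \<mu> x) (glue lam \<mu> y) =
        (circ (lam x) (lam y) + lV \<Omega>' (\<mu> x) (lam y) + rV \<Omega>' (\<mu> y) (lam x) + fV \<Omega>' (\<mu> x) (\<mu> y))
        + (starV \<Omega>' (\<mu> x) (\<mu> y) + lA \<Omega>' (lam x) (\<mu> y) + rA \<Omega>' (lam y) (\<mu> x))"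
      using that by (simp add: glueV unified_on_sum_apply ins)
    then show ?thesis
      using that
      by (simp add: unified_on_sum_parts(6)[OF D closed(1) closed(1)] glue_eq ins \<nu>_add lam_add
          diff_diff_add)
  qed
  have brVV: "glue lam \<mu> (snd (\<Psi> \<Omega>) x y) = snd (\<Psi> \<Omega>') (glue lam \<mu> x) (glue lam \<mu> y) \<longleftrightarrow>
      hV \<Omega> x y = brk (lam x) (lam y) + triR \<Omega>' (\<mu> x) (lam y) - triR \<Omega>' (\<mu> y) (lam x)
         + hV \<Omega>' (\<mu> x) (\<mu> y) - lam (\<nu> (brV \<Omega>' (\<mu> x) (\<mu> y)))
         - lam (\<nu> (triL \<Omega>' (\<mu> x) (lam y))) + lam (\<nu> (triL \<Omega>' (\<mu> y) (lam x)))
      \<and> brV \<Omega> x y =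
         \<nu> (brV \<Omega>' (\<mu> x) (\<mu> y)) + \<nu> (triL \<Omega>' (\<mu> x) (lam y)) - \<nu> (triL \<Omega>' (\<mu> y) (lam x))"
    if "x \<in> V" "y \<in> V" for x y
  proof -
    have "snd (\<Psi> \<Omega>') (glue lam \<mu> x) (glue lam \<mu> y) =
        (brk (lam x) (lam y) + triR \<Omega>' (\<mu> x) (lam y) - triR \<Omega>' (\<mu> y) (lam x) + hV \<Omega>' (\<mu> x) (\<mu> y))
        + (brV \<Omega>' (\<mu> x) (\<mu> y) + triL \<Omega>' (\<mu> x) (lam y) - triL \<Omega>' (\<mu> y) (lam x))"
      using that by (simp add: glueV unified_on_sum_apply ins)
    \<comment> \<open>Spreads the subtracted \<open>lam\<close>-term into three summands, matching
      the form of the equation for \<open>hV\<close>.\<close>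
    moreover have diff_distrib: "p - (q + r - z) = p - q - r + z" for p q r z :: 'e
      by simp
    ultimately show ?thesis
      using that
      by (simp add: unified_on_sum_parts(7)[OF D closed(1) closed(1)] glue_eq ins \<nu>_add lam_add
          \<nu>_diff lam_diff diff_distrib)
  qed
  show ?thesis
    unfolding iso
      extd_hom_iff[OF unified_on_sum_extd[OF \<Omega>] unified_on_sum_extd[OF \<Omega>'] lin glueA]
      gd_equations_def Let_def \<nu>_def[symmetric] fst_conv snd_conv
    \<comment> \<open>Once the five pairs are split, the two sides differ only in the order of the
      ten conjuncts.\<close>
    by (simp only: VA AV brVA VV brVV ball_conj_distrib cong: ball_cong) blast
qed

text \<open>Pairs \<open>lam\<close>, \<open>\<mu>\<close> with \<open>\<mu>\<close> bijective
  correspond to automorphisms of \<open>E\<close> fixing \<open>A\<close>: one direction forms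
  \<open>glue lam \<mu>\<close>, the other takes the components of \<open>\<phi>\<close> on
  \<open>V\<close>.\<close>

lemma gd_rel_iff:
  "(\<Omega>, \<Omega>') \<in> gd_rel scale A (circ, brk) V \<longleftrightarrow>
    \<Omega> \<in> GD scale A (circ, brk) V \<and> \<Omega>' \<in> GD scale A (circ, brk) V \<and>
    (\<Psi> \<Omega>, \<Psi> \<Omega>') \<in> extd_rel scale A (circ, brk)"
proof (cases "\<Omega> \<in> GD scale A (circ, brk) V \<and> \<Omega>' \<in> GD scale A (circ, brk) V")
  case True
  then have \<Omega>: "\<Omega> \<in> GD scale A (circ, brk) V" and \<Omega>': "\<Omega>' \<in> GD scale A (circ, brk) V"
    by simp_all
  have "(\<exists>lam \<mu>. linear_on scale V A lam \<and> linear_on scale V V \<mu> \<and> bij_betw \<mu> V V \<and>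
          gd_equations A (circ, brk) V \<Omega> \<Omega>' lam \<mu>) \<longleftrightarrow>
      (\<exists>\<phi>. gd_iso scale UNIV (\<Psi> \<Omega>) UNIV (\<Psi> \<Omega>') \<phi> \<and> (\<forall>a\<in>A. \<phi> a = a))" (is "?L \<longleftrightarrow> ?R")
  proof
    assume ?L
    then obtain lam \<mu> where lam: "linear_on scale V A lam" and \<mu>: "linear_on scale V V \<mu>"
      and bij: "bij_betw \<mu> V V" and eqs: "gd_equations A (circ, brk) V \<Omega> \<Omega>' lam \<mu>"
      by blast
    \<comment> \<open>Cancellation gives that both maps vanish at 0, the \<open>V\<close>-part of
      any element of \<open>A\<close>.\<close>
    have "lam (0 + 0) = lam 0 + lam 0" "\<mu> (0 + 0) = \<mu> 0 + \<mu> 0"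
      using lam \<mu> closed(5) unfolding linear_on_def by blast+
    then have "\<forall>a\<in>A. glue lam \<mu> a = a" by (simp add: glue_def)
    then show ?R using glue_gd_iso_iff[OF \<Omega> \<Omega>' lam \<mu> bij] eqs by blast
  next
    assume ?R
    then obtain \<phi> where iso: "gd_iso scale UNIV (\<Psi> \<Omega>) UNIV (\<Psi> \<Omega>') \<phi>" and \<phi>A: "\<forall>a\<in>A. \<phi> a = a"
      by blast
    define lam where "lam = (\<lambda>x. prA (\<phi> x))"
    define \<mu> where "\<mu> = (\<lambda>x. prV (\<phi> x))"
    have "bij \<phi>" and add: "\<phi> (u + w) = \<phi> u + \<phi> w" and sc: "\<phi> (scale c u) = scale c (\<phi> u)" for u w c
      using iso by (auto simp: gd_iso_def gd_hom_def linear_on_def)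
    have lam: "linear_on scale V A lam" and \<mu>: "linear_on scale V V \<mu>"
      by (simp_all add: lam_def \<mu>_def linear_on_def add sc)
    have glue: "glue lam \<mu> = \<phi>"
    proof
      fix e
      have "glue lam \<mu> e = prA e + \<phi> (prV e)"
        by (simp add: glue_def lam_def \<mu>_def pr_sum add.assoc)
      also have "\<dots> = \<phi> (prA e + prV e)" by (simp add: add \<phi>A)
      finally show "glue lam \<mu> e = \<phi> e" by (simp add: pr_sum)
    qed
    have "bij_betw \<mu> V V"
    proof (rule bij_betw_imageI)
      show "inj_on \<mu> V"
      proof (rule inj_onI)
        fix x y assume xy: "x \<in> V" "y \<in> V" and "\<mu> x = \<mu> y"
        \<comment> \<open>If \<open>\<mu> x = \<mu> y\<close>, then \<open>\<phi> x\<close> and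
          \<open>\<phi> y\<close> differ by \<open>lam x - lam y\<close>, which lies in
          \<open>A\<close> and is fixed by \<open>\<phi>\<close>. Injectivity of
          \<open>\<phi>\<close> removes \<open>\<phi>\<close>, and directness of the sum gives
          \<open>x = y\<close>.\<close>
        then have "\<phi> x + lam y = \<phi> y + lam x"
          unfolding glue[symmetric] by (simp add: glue_def add.commute add.left_commute)
        then have "\<phi> (lam y + x) = \<phi> (lam x + y)"
          by (simp add: add \<phi>A lam_def add.commute)
        then have "lam y + x = lam x + y" using \<open>bij \<phi>\<close> by (simp add: bij_is_inj inj_eq)
        then show "x = y" using xy by (subst (asm) sum_eq_iff) (simp_all add: lam_def)
      qed
      have "y \<in> \<mu> ` V" if "y \<in> V" for y
      proof -
        \<comment> \<open>The \<open>V\<close>-part of a preimage under \<open>\<phi>\<close> is a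
          preimage under \<open>\<mu>\<close>, because \<open>\<phi>\<close> fixes the
          \<open>A\<close>-part, which has no \<open>V\<close>-component.\<close>
        obtain e where "\<phi> e = y" using \<open>bij \<phi>\<close> by (metis bij_pointE)
        then have "\<phi> (prA e + prV e) = y" by (simp add: pr_sum)
        then have "prV (prA e + \<phi> (prV e)) = y" using that by (simp add: add \<phi>A)
        then have "\<mu> (prV e) = y" by (simp add: \<mu>_def)
        then show ?thesis by (rule image_eqI[OF sym prV_in])
      qed
      then show "\<mu> ` V = V" by (auto simp: \<mu>_def)
    qed
    then show ?L using glue_gd_iso_iff[OF \<Omega> \<Omega>' lam \<mu>] iso lam \<mu> unfolding glue by blast
  qed
  then show ?thesis
    using True unified_on_sum_extd[OF \<Omega>] unified_on_sum_extd[OF \<Omega>']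
    unfolding gd_rel_def extd_rel_def mem_Collect_eq case_prod_conv by blast
qed (auto simp: gd_rel_def)

end

section \<open>The bijection of quotients\<close>

text \<open>The two \<open>equiv\<close> claims make both quotients sets of genuine equivalence
  classes. The equation for \<open>F\<close> on the class of each datum determines \<open>F\<close>
  on \<open>GH2\<close>, so its existence includes well-definedness of the map.\<close>

theorem theorem3p10:
  fixes scale :: "'k::field \<Rightarrow> 'e::ab_group_add \<Rightarrow> 'e"
    and A V :: "'e set"
    and circ brk :: "'e \<Rightarrow> 'e \<Rightarrow> 'e"
  assumes "vector_space scale"
    and "module.subspace scale A"
    and "gd_bialgebra scale A (circ, brk)"
    and "module.subspace scale V"
    and "A \<inter> V = {0}"
    and "\<forall>e. \<exists>a\<in>A. \<exists>v\<in>V. e = a + v"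
  shows "equiv (GD scale A (circ, brk) V) (gd_rel scale A (circ, brk) V)
    \<and> equiv (extd_structures scale A (circ, brk)) (extd_rel scale A (circ, brk))
    \<and> (\<exists>F. (\<forall>\<Omega> \<in> GD scale A (circ, brk) V.
                unified_on_sum A (circ, brk) V \<Omega> \<in> extd_structures scale A (circ, brk) \<and>
                F (gd_rel scale A (circ, brk) V `` {\<Omega>})
                  = extd_rel scale A (circ, brk) `` {unified_on_sum A (circ, brk) V \<Omega>})
           \<and> bij_betw F (GH2 scale A (circ, brk) V) (Extd scale A (circ, brk)))"
proof -
  interpret gd_extending scale A V circ brk
    using assms
    by (simp add: gd_extending_def direct_sum_def direct_sum_axioms_def gd_extending_axioms_def)
  have surj: "\<Psi> ` GD scale A (circ, brk) V = extd_structures scale A (circ, brk)"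
    using unified_on_sum_extd extd_unified_on_sum by blast
  note pullback = pullback_equiv_quotient_bij[OF equiv_extd_rel surj gd_rel_iff]
  obtain F where F: "\<forall>\<Omega>\<in>GD scale A (circ, brk) V. F (gd_rel scale A (circ, brk) V `` {\<Omega>})
        = extd_rel scale A (circ, brk) `` {\<Psi> \<Omega>}"
      "bij_betw F (GH2 scale A (circ, brk) V) (Extd scale A (circ, brk))"
    using pullback(2) unfolding GH2_def Extd_def by blast
  show ?thesis
    using pullback(1) equiv_extd_rel F unified_on_sum_extd by (intro conjI exI[of _ F]) simp_all
qed

end
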